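(* Let $\Omega\subset\mathbb{R}^n$ be a domain, $1<p<\infty$, and for $h=1,\dots,n$ let $\mathscr{A}^h(x)=\{a^h_{ij}(x)\}_{i,j=1}^m$ be an $m\times m$ matrix of complex-valued locally integrable functions on $\Omega$. The operator $Au=\sum_{h=1}^n\partial_h(\mathscr{A}^h(x)\partial_hu)$ is $L^p$-dissipative if and only if $$\mathrm{Re}\langle\mathscr{A}^h(x)\lambda,\lambda\rangle-(1-2/p)^2\,\mathrm{Re}\langle\mathscr{A}^h(x)\omega,\omega\rangle(\mathrm{Re}\langle\lambda,\omega\rangle)^2-(1-2/p)\,\mathrm{Re}\big(\langle\mathscr{A}^h(x)\omega,\lambda\rangle-\langle\mathscr{A}^h(x)\lambda,\omega\rangle\big)\mathrm{Re}\langle\lambda,\omega\rangle\geq0$$ for almost every $x\in\Omega$, for any $\lambda,\omega\in\mathbb{C}^m$ with $|\omega|=1$, and for $h=1,\dots,n$.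
   Context: $\langle\cdot,\cdot\rangle$ is the standard Hermitian scalar product in $\mathbb{C}^m$ (linear in the first argument) and $\partial_h=\partial/\partial x_h$. $(C_0^1(\Omega))^m$ is the space of $C^1$ functions $\Omega\to\mathbb{C}^m$ with compact support in $\Omega$. The sesquilinear form of $A$ is $\mathscr{L}(u,v)=\int_\Omega\sum_{h=1}^n\langle\mathscr{A}^h(x)\partial_hu,\partial_hv\rangle\,dx$ for $u,v\in(C_0^1(\Omega))^m$. With $p'=p/(p-1)$, $A$ is called $L^p$-dissipative if for all $u\in(C_0^1(\Omega))^m$: $\mathrm{Re}\,\mathscr{L}(u,|u|^{p-2}u)\ge0$ when $p\ge2$, and $\mathrm{Re}\,\mathscr{L}(|u|^{p'-2}u,u)\ge0$ when $1<p<2$. *)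

theory Defs
  imports "HOL-Analysis.Analysis"
begin

definition herm_inner :: "complex ^ 'm \<Rightarrow> complex ^ 'm \<Rightarrow> complex"
  where "herm_inner u v = (\<Sum>i\<in>UNIV. u $ i * cnj (v $ i))"

definition partial_deriv ::
    "'n \<Rightarrow> (real ^ 'n \<Rightarrow> 'b :: real_normed_vector) \<Rightarrow> real ^ 'n \<Rightarrow> 'b"
  where "partial_deriv h u x = vector_derivative (\<lambda>t. u (x + t *\<^sub>R axis h 1)) (at 0)"

(* Functions on \<Omega> are total functions whose values outside \<Omega> are irrelevant: for open \<Omega>,
   both conditions depend only on the restriction of u to \<Omega>. *)
definition C1_compact_support ::
    "(real ^ 'n) set \<Rightarrow> (real ^ 'n \<Rightarrow> 'b :: real_normed_vector) set"
  where "C1_compact_support \<Omega> = {u.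
    (\<exists>u'. (\<forall>x\<in>\<Omega>. (u has_derivative blinfun_apply (u' x)) (at x)) \<and> continuous_on \<Omega> u') \<and>
    compact (closure (support_on \<Omega> u)) \<and> closure (support_on \<Omega> u) \<subseteq> \<Omega>}"

definition locally_integrable_on ::
    "('a :: euclidean_space \<Rightarrow> 'b :: {banach, second_countable_topology}) \<Rightarrow> 'a set \<Rightarrow> bool"
    (infix "locally'_integrable'_on" 46)
  where "f locally_integrable_on \<Omega> \<longleftrightarrow>
    (\<forall>K. compact K \<and> K \<subseteq> \<Omega> \<longrightarrow> set_integrable lebesgue K f)"

definition sesq_form ::
    "(real ^ 'n) set \<Rightarrow> ('n \<Rightarrow> real ^ 'n \<Rightarrow> complex ^ 'm ^ 'm) \<Rightarrow>
     (real ^ 'n \<Rightarrow> complex ^ 'm) \<Rightarrow> (real ^ 'n \<Rightarrow> complex ^ 'm) \<Rightarrow> complex"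
  where "sesq_form \<Omega> A u v =
    (LINT x:\<Omega>|lebesgue. (\<Sum>h\<in>UNIV. herm_inner (A h x *v partial_deriv h u x) (partial_deriv h v x)))"

(* |u|^s u.  Since 0 powr s = 0 for every s, the value is 0 wherever u vanishes, also for s = 0. *)
definition norm_powr_scale :: "real \<Rightarrow> ('a \<Rightarrow> 'b :: real_normed_vector) \<Rightarrow> 'a \<Rightarrow> 'b"
  where "norm_powr_scale s u x = (norm (u x) powr s) *\<^sub>R u x"

definition Lp_dissipative ::
    "real \<Rightarrow> (real ^ 'n) set \<Rightarrow> ('n \<Rightarrow> real ^ 'n \<Rightarrow> complex ^ 'm ^ 'm) \<Rightarrow> bool"
  where "Lp_dissipative p \<Omega> A \<longleftrightarrow>
    (\<forall>u \<in> C1_compact_support \<Omega>.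
      if p \<ge> 2 then Re (sesq_form \<Omega> A u (norm_powr_scale (p - 2) u)) \<ge> 0
      else Re (sesq_form \<Omega> A (norm_powr_scale (p / (p - 1) - 2) u) u) \<ge> 0)"

end

theory Submission
  imports Defs
begin

text \<open>
  For \<open>p \<ge> 2\<close> put \<open>s = p - 2\<close> and let \<open>D\<^sub>z\<close> be the derivative of \<open>z \<mapsto> |z|\<^sup>s z\<close>. The integrand of
  \<open>\<L>(u, |u|\<^sup>s u)\<close> is the sum over \<open>h\<close> of \<open>\<langle>A\<^sup>h \<xi>, D\<^sub>z \<xi>\<rangle>\<close> at \<open>z = u\<close>, \<open>\<xi> = \<partial>\<^sub>h u\<close>, and a linear substitution
  turns the algebraic condition into \<open>Re \<langle>A\<^sup>h \<xi>, D\<^sub>z \<xi>\<rangle> \<ge> 0\<close> for all \<open>z\<close> and \<open>\<xi>\<close>. This makes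
  sufficiency a pointwise statement. For necessity, functions that oscillate rapidly in direction
  \<open>x\<^sub>h\<close> around a cutoff multiple of \<open>\<omega>\<close> yield \<open>\<integral> \<psi>\<^sup>p Re \<langle>A\<^sup>h \<mu>, D\<^sub>\<omega> \<mu>\<rangle> \<ge> 0\<close> for every cutoff \<open>\<psi> \<ge> 0\<close>; letting \<open>\<psi>\<close> tend to
  indicators of compact sets localises this, and a countable dense set of \<open>(\<omega>, \<mu>)\<close> collects the null
  sets. The case \<open>p < 2\<close> follows by duality: replacing \<open>A\<^sup>h\<close> by its adjoint exchanges \<open>p\<close> and
  \<open>p / (p - 1)\<close> on both sides of the equivalence.
\<close>

section \<open>The derivative of the power map\<close>

text \<open>
  The derivative of \<open>z \<mapsto> |z|\<^sup>s z\<close> for \<open>s \<ge> 0\<close>. The case \<open>s = 0\<close> is separate because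
  \<open>0 powr 0 = 0\<close> would make the value at \<open>z = 0\<close> wrong.
\<close>
definition powr_scale_deriv :: "real \<Rightarrow> 'a::real_inner \<Rightarrow> 'a \<Rightarrow> 'a"
  where "powr_scale_deriv s z \<xi> =
    (if s = 0 then \<xi> else (norm z powr s) *\<^sub>R (\<xi> + (s * (sgn z \<bullet> \<xi>)) *\<^sub>R sgn z))"

lemma powr_scale_deriv_unit:
  assumes "norm z = 1"
  shows "powr_scale_deriv s z \<xi> = \<xi> + (s * (z \<bullet> \<xi>)) *\<^sub>R z"
  using assms by (simp add: powr_scale_deriv_def sgn_div_norm)

lemma powr_scale_deriv_nonzero:
  assumes "z \<noteq> 0"
  shows "powr_scale_deriv s z \<xi> = (norm z powr s) *\<^sub>R (powr_scale_deriv s (sgn z) \<xi>)"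
  using assms by (auto simp: powr_scale_deriv_def norm_sgn sgn_div_norm[of "sgn z"])

lemma powr_scale_deriv_scaleR [simp]:
  "powr_scale_deriv s z (c *\<^sub>R \<xi>) = c *\<^sub>R powr_scale_deriv s z \<xi>"
  by (simp add: powr_scale_deriv_def algebra_simps)

lemma powr_scale_deriv_scaleR_base:
  assumes "0 < c"
  shows "powr_scale_deriv s (c *\<^sub>R z) \<xi> = (c powr s) *\<^sub>R powr_scale_deriv s z \<xi>"
  using assms by (auto simp: powr_scale_deriv_def sgn_scaleR powr_mult)

text \<open>Cauchy-Schwarz and \<open>norm (sgn z) \<le> 1\<close>. The bound singles out
  \<open>s = 0\<close> because \<open>0 powr 0 = 0\<close> would make it fail at
  \<open>z = 0\<close>.\<close>

lemma norm_powr_scale_deriv_le: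
  assumes "0 \<le> s"
  shows "norm (powr_scale_deriv s z \<xi>) \<le> (if s = 0 then 1 else norm z powr s) * (1 + s) * norm \<xi>"
proof (cases "s = 0")
  case False
  have "\<bar>sgn z \<bullet> \<xi>\<bar> \<le> norm (sgn z) * norm \<xi>" by (rule Cauchy_Schwarz_ineq2)
  also have "\<dots> \<le> norm \<xi>" by (auto simp: norm_sgn)
  finally have 1: "\<bar>sgn z \<bullet> \<xi>\<bar> \<le> norm \<xi>" .
  have "norm (\<xi> + (s * (sgn z \<bullet> \<xi>)) *\<^sub>R sgn z) \<le> norm \<xi> + s * \<bar>sgn z \<bullet> \<xi>\<bar> * norm (sgn z)"
    using assms by (intro norm_triangle_le) (simp add: abs_mult)
  also have "\<dots> \<le> norm \<xi> + s * norm \<xi> * 1"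
    using assms 1 by (intro add_left_mono mult_mono) (auto simp: norm_sgn)
  finally have "norm (\<xi> + (s * (sgn z \<bullet> \<xi>)) *\<^sub>R sgn z) \<le> (1 + s) * norm \<xi>"
    by (simp add: algebra_simps)
  from mult_left_mono[OF this, of "norm z powr s"] False show ?thesis
    by (simp add: powr_scale_deriv_def mult.assoc)
qed (simp add: powr_scale_deriv_def)

text \<open>Joint continuity in base point and direction. The delicate point is
  \<open>z0 = 0\<close> with \<open>s > 0\<close>: there \<open>sgn\<close> jumps, but the norm
  bound squeezes the value to 0.\<close>

lemma continuous_powr_scale_deriv:
  fixes z0 \<xi>0 :: "'a::real_inner"
  assumes "0 \<le> s"
  shows "isCont (\<lambda>(z, \<xi>). powr_scale_deriv s z \<xi>) (z0, \<xi>0)"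
proof -
  consider "s = 0" | "z0 \<noteq> 0" | "s > 0" "z0 = 0" using assms by fastforce
  then show ?thesis
  proof cases
    case 1
    have "isCont snd (z0, \<xi>0)" by (intro continuous_intros)
    moreover have "(\<lambda>(z, \<xi>). powr_scale_deriv s z \<xi>) = (snd :: 'a \<times> 'a \<Rightarrow> 'a)"
      using 1 by (auto simp: powr_scale_deriv_def)
    ultimately show ?thesis by simp
  next
    case 2
    then show ?thesis
      unfolding powr_scale_deriv_def isCont_def case_prod_unfold
      by (cases "s = 0") (auto intro!: tendsto_eq_intros)
  next
    case 3
    have "((\<lambda>x::'a\<times>'a. norm (fst x) powr s * (1 + s) * norm (snd x)) \<longlongrightarrow> norm z0 powr s * (1 + s) * norm \<xi>0) (at (z0, \<xi>0))"
      using 3 by (intro tendsto_intros tendsto_powr') (auto intro!: tendsto_eq_intros)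
    then have "((\<lambda>x::'a\<times>'a. norm (fst x) powr s * (1 + s) * norm (snd x)) \<longlongrightarrow> 0) (at (z0, \<xi>0))"
      using 3 by simp
    then have "((\<lambda>x. powr_scale_deriv s (fst x) (snd x)) \<longlongrightarrow> 0) (at (z0, \<xi>0))"
      by (rule Lim_null_comparison[rotated])
        (use norm_powr_scale_deriv_le[OF assms] 3 in \<open>auto intro!: always_eventually\<close>)
    then show ?thesis
      using 3 by (simp add: isCont_def case_prod_unfold powr_scale_deriv_def)
  qed
qed

lemma continuous_on_powr_scale_deriv [continuous_intros]:
  assumes "0 \<le> s" "continuous_on S f" "continuous_on S g"
  shows "continuous_on S (\<lambda>x. powr_scale_deriv s (f x) (g x :: 'a::real_inner))"
proof -
  have "continuous_on UNIV (\<lambda>(z, \<xi>::'a). powr_scale_deriv s z \<xi>)"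
    using continuous_powr_scale_deriv[OF assms(1)] by (auto intro!: continuous_at_imp_continuous_on)
  from continuous_on_compose2[OF this continuous_on_Pair[OF assms(2,3)]] show ?thesis by simp
qed

text \<open>Away from 0 this is the product rule. At 0 with \<open>s > 0\<close> the map is of
  smaller order than \<open>norm z\<close>, since \<open>norm z powr s\<close> tends to 0. Hence
  \<open>norm_powr_scale s u\<close> is differentiable also at the zeros of
  \<open>u\<close>.\<close>

lemma has_derivative_norm_powr_scale:
  fixes z :: "'a::real_inner"
  assumes "0 \<le> s"
  shows "((\<lambda>z. (norm z powr s) *\<^sub>R z) has_derivative powr_scale_deriv s z) (at z)"
proof -
  consider "s = 0" | "s > 0" "z \<noteq> 0" | "s > 0" "z = 0" using assms by fastforce
  then show ?thesis
  proof cases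
    case 1
    have "(\<lambda>z::'a. (norm z powr s) *\<^sub>R z) = (\<lambda>z. z)" "powr_scale_deriv s z = (\<lambda>z. z)"
      using 1 by (auto simp: powr_scale_deriv_def fun_eq_iff)
    then show ?thesis by simp
  next
    case 2
    have n: "(norm has_derivative (\<lambda>h. h \<bullet> sgn z)) (at z)"
      using has_derivative_norm[of z] 2 by simp
    have p: "((\<lambda>x::real. x powr s) has_real_derivative s * norm z powr (s - 1)) (at (norm z))"
      using 2 by (intro has_real_derivative_powr) auto
    have "((\<lambda>z. norm z powr s) has_derivative (\<lambda>h. s * norm z powr (s - 1) * (h \<bullet> sgn z))) (at z)"
      using has_derivative_compose[OF n p[unfolded has_field_derivative_def]] by simp
    from has_derivative_scaleR[OF this has_derivative_ident]
    show ?thesis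
      by (rule has_derivative_eq_rhs)
        (use 2 in \<open>auto simp: fun_eq_iff powr_scale_deriv_def algebra_simps powr_diff sgn_div_norm inner_commute divide_inverse\<close>)
  next
    case 3
    have "((\<lambda>y. norm y powr s) \<longlongrightarrow> norm (0::'a) powr s) (at 0)"
      using 3 by (intro tendsto_powr') (auto intro!: tendsto_eq_intros)
    then have "((\<lambda>y::'a. norm ((norm y powr s) *\<^sub>R y) / norm y) \<longlongrightarrow> 0) (at 0)"
      using 3 by (auto elim!: Lim_transform_eventually simp: eventually_at_filter)
    moreover have "powr_scale_deriv s z = (\<lambda>_. 0)"
      using 3 by (auto simp: powr_scale_deriv_def)
    ultimately show ?thesis
      using 3 by (simp add: has_derivative_iff_norm)
  qed
qed

section \<open>Partial derivatives and the Hermitian product\<close>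

lemma partial_deriv_eq:
  assumes "(u has_derivative u') (at x)"
  shows "partial_deriv h u x = u' (axis h 1)"
proof -
  have "((\<lambda>t. x + t *\<^sub>R axis h 1) has_derivative (\<lambda>t. t *\<^sub>R axis h 1)) (at 0)"
    by (auto intro!: derivative_eq_intros)
  moreover have "(u has_derivative u') (at (x + (0::real) *\<^sub>R axis h 1))" using assms by simp
  ultimately have "((\<lambda>t. u (x + t *\<^sub>R axis h 1)) has_derivative (\<lambda>t. u' (t *\<^sub>R axis h 1))) (at 0)"
    by (rule has_derivative_compose)
  moreover have "u' (t *\<^sub>R axis h 1) = t *\<^sub>R u' (axis h 1)" for t
    using assms by (simp add: has_derivative_def linear_scale bounded_linear.linear)
  ultimately show ?thesis
    unfolding partial_deriv_def
    by (auto intro!: vector_derivative_at simp: has_vector_derivative_def)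
qed

lemma partial_deriv_norm_powr_scale:
  assumes "0 \<le> s" "(u has_derivative u') (at x)"
  shows "partial_deriv h (norm_powr_scale s u) x = powr_scale_deriv s (u x) (partial_deriv h u x)"
proof -
  have "(norm_powr_scale s u has_derivative (\<lambda>h. powr_scale_deriv s (u x) (u' h))) (at x)"
    unfolding norm_powr_scale_def[abs_def]
    using has_derivative_compose[OF assms(2) has_derivative_norm_powr_scale[OF assms(1)]] .
  then show ?thesis using assms(2) by (simp add: partial_deriv_eq)
qed

lemma Re_herm_inner: "Re (herm_inner u v) = u \<bullet> v"
  by (simp add: herm_inner_def inner_vec_def inner_complex_def)

lemma herm_inner_scaleR_left [simp]: "herm_inner (c *\<^sub>R u) w = c *\<^sub>R herm_inner u w"
  and herm_inner_scaleR_right [simp]: "herm_inner u (c *\<^sub>R w) = c *\<^sub>R herm_inner u w"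
  by (simp_all add: herm_inner_def algebra_simps sum.distrib scaleR_sum_right)

lemma herm_inner_matrix_vector_mult:
  "herm_inner (M *v u) v = (\<Sum>i\<in>UNIV. \<Sum>j\<in>UNIV. M $ i $ j * (u $ j * cnj (v $ i)))"
  by (simp add: herm_inner_def matrix_vector_mult_def sum_distrib_left sum_distrib_right algebra_simps)

text \<open>The crude entrywise constant is chosen because, as a function of \<open>x\<close>, it
  inherits integrability on compact sets from the coefficients and so yields a dominating
  function.\<close>

lemma norm_herm_inner_matrix_le:
  "norm (herm_inner (M *v u) v) \<le> (\<Sum>i\<in>UNIV. \<Sum>j\<in>UNIV. norm (M $ i $ j)) * (norm u * norm v)"
proof -
  have "norm (herm_inner (M *v u) v) \<le> (\<Sum>i\<in>UNIV. \<Sum>j\<in>UNIV. norm (M $ i $ j) * (norm u * norm v))"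
    unfolding herm_inner_matrix_vector_mult
    by (intro sum_norm_le) (auto simp: norm_mult intro!: mult_mono Finite_Cartesian_Product.norm_nth_le)
  then show ?thesis by (simp add: sum_distrib_right)
qed

lemma matrix_scaleR_vector [simp]: "M *v (c *\<^sub>R u) = c *\<^sub>R (M *v (u :: complex ^ 'm))"
  by (vector matrix_vector_mult_def scaleR_sum_right)

section \<open>The algebraic condition as positivity of a form\<close>

text \<open>Exponent and matrix are both arguments, so that the duality argument can replace them
  together.\<close>

definition dissipativity_form :: "real \<Rightarrow> complex ^ 'm ^ 'm \<Rightarrow> complex ^ 'm \<Rightarrow> complex ^ 'm \<Rightarrow> real"
  where "dissipativity_form p M l \<omega> =
      Re (herm_inner (M *v l) l)
      - (1 - 2 / p)\<^sup>2 * Re (herm_inner (M *v \<omega>) \<omega>) * (Re (herm_inner l \<omega>))\<^sup>2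
      - (1 - 2 / p) * Re (herm_inner (M *v \<omega>) l - herm_inner (M *v l) \<omega>)
          * Re (herm_inner l \<omega>)"

text \<open>
  The (invertible) substitution for \<open>l\<close> is the pointwise form of passing from \<open>u\<close> to
  \<open>v = |u| powr ((p - 2) / 2) u\<close>, with \<open>\<omega> = v / |v|\<close> and \<open>l\<close> proportional to a derivative of \<open>v\<close>.
\<close>
lemma dissipativity_form_eq:
  assumes p: "2 \<le> p" and \<omega>: "norm \<omega> = 1"
  shows "dissipativity_form p M (\<xi> + (((p - 2) / 2) * (\<omega> \<bullet> \<xi>)) *\<^sub>R \<omega>) \<omega> =
    Re (herm_inner (M *v \<xi>) (powr_scale_deriv (p - 2) \<omega> \<xi>))"
proof -
  define l where "l = \<xi> + (((p - 2) / 2) * (\<omega> \<bullet> \<xi>)) *\<^sub>R \<omega>"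
  define R where "R = l \<bullet> \<omega>"
  define c where "c = 1 - 2 / p"
  have ww: "\<omega> \<bullet> \<omega> = 1" using \<omega> by (simp add: norm_eq_1)
  have "R = (p / 2) * (\<omega> \<bullet> \<xi>)"
    unfolding R_def l_def using ww by (simp add: inner_add_left inner_commute algebra_simps diff_divide_distrib)
  then have r: "\<omega> \<bullet> \<xi> = (2 / p) * R" using p by (simp add: field_simps)
  \<comment> \<open>The vector \<open>l\<close> lies midway between \<open>\<xi>\<close> and its
    image under the derivative: these are \<open>l - (c * R) *\<^sub>R \<omega>\<close> and
    \<open>l + (c * R) *\<^sub>R \<omega>\<close>, and expanding their product gives the
    form.\<close>
  have cR: "((p - 2) / 2) * (\<omega> \<bullet> \<xi>) = c * R" unfolding r c_def using p by (simp add: field_simps)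
  have \<xi>: "\<xi> = l - (c * R) *\<^sub>R \<omega>" unfolding l_def cR by simp
  have "powr_scale_deriv (p - 2) \<omega> \<xi> = l + (((p - 2) / 2) * (\<omega> \<bullet> \<xi>)) *\<^sub>R \<omega>"
    unfolding powr_scale_deriv_unit[OF \<omega>] l_def by (simp add: algebra_simps flip: scaleR_add_left)
  then have D: "powr_scale_deriv (p - 2) \<omega> \<xi> = l + (c * R) *\<^sub>R \<omega>" unfolding cR .
  have "Re (herm_inner (M *v \<xi>) (powr_scale_deriv (p - 2) \<omega> \<xi>)) =
      (M *v l - (c * R) *\<^sub>R (M *v \<omega>)) \<bullet> (l + (c * R) *\<^sub>R \<omega>)"
    unfolding Re_herm_inner D by (subst (1) \<xi>) (simp add: matrix_vector_mult_diff_distrib)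
  also have "\<dots> = dissipativity_form p M l \<omega>"
    unfolding dissipativity_form_def minus_complex.sel Re_herm_inner R_def[symmetric] c_def[symmetric]
    by (simp add: inner_diff_left inner_add_right algebra_simps power2_eq_square)
  finally show ?thesis unfolding l_def ..
qed

text \<open>For a fixed unit vector the substitution between \<open>\<xi>\<close> and
  \<open>l\<close> is invertible, and homogeneity in \<open>z\<close> reduces nonzero
  \<open>z\<close> to unit vectors.\<close>

lemma dissipativity_form_nonneg_iff:
  assumes p: "2 \<le> p"
  shows "(\<forall>l \<omega>. norm \<omega> = 1 \<longrightarrow> 0 \<le> dissipativity_form p M l \<omega>) \<longleftrightarrow>
    (\<forall>\<xi> z. 0 \<le> Re (herm_inner (M *v \<xi>) (powr_scale_deriv (p - 2) z \<xi>)))" (is "?L \<longleftrightarrow> ?R")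
proof
  assume L: ?L
  then have unit: "0 \<le> Re (herm_inner (M *v \<xi>) (powr_scale_deriv (p - 2) \<omega> \<xi>))" if "norm \<omega> = 1" for \<xi> \<omega>
    using dissipativity_form_eq[OF p that, of M \<xi>] that by metis
  show ?R
  proof (intro allI)
    fix \<xi> z
    show "0 \<le> Re (herm_inner (M *v \<xi>) (powr_scale_deriv (p - 2) z \<xi>))"
    proof (cases "z = 0")
      case True
      show ?thesis
      \<comment> \<open>For \<open>p = 2\<close> the derivative is the identity at every base point,
        so any unit vector may replace \<open>z = 0\<close>; for \<open>p > 2\<close> the derivative
        at 0 vanishes.\<close>
      proof (cases "p = 2")
        case True
        then show ?thesis
          using unit[of "axis undefined 1" \<xi>] by (simp add: powr_scale_deriv_def)
      next
        case False
        with \<open>z = 0\<close> show ?thesis by (simp add: powr_scale_deriv_def Re_herm_inner)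
      qed
    next
      case False
      then show ?thesis
        by (subst powr_scale_deriv_nonzero) (use unit[of "sgn z" \<xi>] in \<open>auto simp: norm_sgn\<close>)
    qed
  qed
next
  assume R: ?R
  show ?L
  proof (intro allI impI)
    fix l \<omega> :: "complex ^ 'a"
    assume \<omega>: "norm \<omega> = 1"
    \<comment> \<open>The inverse of the substitution; it scales the component along
      \<open>\<omega>\<close> by \<open>2 / p\<close>.\<close>
    define \<xi> where "\<xi> = l - ((1 - 2 / p) * (\<omega> \<bullet> l)) *\<^sub>R \<omega>"
    have ww: "\<omega> \<bullet> \<omega> = 1" using \<omega> by (simp add: norm_eq_1)
    have "\<omega> \<bullet> \<xi> = (2 / p) * (\<omega> \<bullet> l)"
      unfolding \<xi>_def using ww by (simp add: inner_diff_right algebra_simps)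
    then have "\<xi> + (((p - 2) / 2) * (\<omega> \<bullet> \<xi>)) *\<^sub>R \<omega> = l"
      unfolding \<xi>_def using p by (simp add: field_simps)
    then show "0 \<le> dissipativity_form p M l \<omega>"
      using dissipativity_form_eq[OF p \<omega>, of M \<xi>] R by simp
  qed
qed

section \<open>Sufficiency for \<open>p \<ge> 2\<close>\<close>

lemma Lp_dissipative_sufficient:
  fixes A :: "'n \<Rightarrow> real ^ 'n \<Rightarrow> complex ^ 'm ^ 'm"
  assumes p: "2 \<le> p"
    and nonneg: "AE x\<in>\<Omega> in lebesgue. \<forall>\<xi> z h.
      0 \<le> Re (herm_inner (A h x *v \<xi>) (powr_scale_deriv (p - 2) z \<xi>))"
  shows "Lp_dissipative p \<Omega> A"
proof -
  have "0 \<le> Re (sesq_form \<Omega> A u (norm_powr_scale (p - 2) u))" if u: "u \<in> C1_compact_support \<Omega>" for u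
  proof -
    let ?f = "\<lambda>x. indicator \<Omega> x *\<^sub>R (\<Sum>h\<in>UNIV. herm_inner (A h x *v partial_deriv h u x)
        (partial_deriv h (norm_powr_scale (p - 2) u) x))"
    have "AE x in lebesgue. 0 \<le> Re (?f x)"
      using nonneg
    proof eventually_elim
      case (elim x)
      show ?case
      proof (cases "x \<in> \<Omega>")
        case True
        with u obtain u' where "(u has_derivative u') (at x)"
          by (auto simp: C1_compact_support_def)
        with True elim p show ?thesis
          by (auto simp: partial_deriv_norm_powr_scale intro!: sum_nonneg)
      qed simp
    qed
    then have "0 \<le> (LINT x|lebesgue. Re (?f x))" by (rule integral_nonneg_AE)
    \<comment> \<open>If the integrand is not integrable, its integral is 0 by convention and the
      inequality still holds.\<close>
    then have "0 \<le> Re (integral\<^sup>L lebesgue ?f)"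
      by (cases "integrable lebesgue ?f") (auto simp: not_integrable_integral_eq simp del: scaleR_complex.sel Re_sum)
    then show ?thesis by (simp add: sesq_form_def set_lebesgue_integral_def)
  qed
  with p show ?thesis by (simp add: Lp_dissipative_def)
qed

section \<open>Cutoff functions\<close>

text \<open>Squaring removes the corner of the truncation; the resulting C^1 function builds all the
  cutoffs.\<close>

lemma has_real_derivative_max_0_square:
  "((\<lambda>t::real. (max 0 t)\<^sup>2) has_real_derivative 2 * max 0 t) (at t)"
proof -
  consider "t > 0" | "t < 0" | "t = 0" by linarith
  then show ?thesis
  proof cases
    case 1
    have "((\<lambda>t::real. t\<^sup>2) has_real_derivative 2 * max 0 t) (at t)"
      using 1 by (auto intro!: derivative_eq_intros)
    then show ?thesis
      by (rule has_field_derivative_transform_within_open[where S="{0<..}"]) (use 1 in auto)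
  next
    case 2
    have "((\<lambda>t::real. 0) has_real_derivative 2 * max 0 t) (at t)"
      using 2 by auto
    then show ?thesis
      by (rule has_field_derivative_transform_within_open[where S="{..<0}"]) (use 2 in auto)
  next
    case 3
    show ?thesis
      unfolding has_field_derivative_iff
      by (rule Lim_null_comparison[where g="\<lambda>h. \<bar>h\<bar>", THEN tendsto_eq_rhs])
        (use 3 in \<open>auto intro!: always_eventually tendsto_eq_intros simp: power2_eq_square max_def divide_simps\<close>)
  qed
qed

text \<open>Finitely many balls of radius \<open>r\<close> centred in \<open>K\<close> cover
  \<open>K\<close>. The sum \<open>S\<close> of the bumps on these balls is positive on
  \<open>K\<close>, hence bounded below there by some \<open>c > 0\<close>. A C^1 function of
  \<open>S / c\<close> that is 0 at 0 and constantly 1 from 1 onwards gives the cutoff.\<close>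

lemma smooth_cutoff:
  fixes K :: "'a::euclidean_space set"
  assumes K: "compact K" and r: "0 < r"
  obtains \<psi> :: "'a \<Rightarrow> real" and G where
    "\<And>x. (\<psi> has_derivative (\<lambda>v. G x \<bullet> v)) (at x)" "continuous_on UNIV G"
    "\<And>x. 0 \<le> \<psi> x" "\<And>x. \<psi> x \<le> 1" "\<And>x. x \<in> K \<Longrightarrow> \<psi> x = 1"
    "\<And>x. (\<And>y. y \<in> K \<Longrightarrow> r \<le> dist x y) \<Longrightarrow> \<psi> x = 0"
proof -
  obtain F where F: "F \<subseteq> K" "finite F" "K \<subseteq> (\<Union>y\<in>F. ball y r)"
  proof (rule compactE_image[OF K])
    show "K \<subseteq> (\<Union>y\<in>K. ball y r)" using r by auto
  qed auto
  define S where "S = (\<lambda>x. \<Sum>y\<in>F. (max 0 (r\<^sup>2 - (x - y) \<bullet> (x - y)))\<^sup>2)"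
  define H where "H = (\<lambda>x. \<Sum>y\<in>F. (-4 * max 0 (r\<^sup>2 - (x - y) \<bullet> (x - y))) *\<^sub>R (x - y))"
  have S_nonneg: "0 \<le> S x" for x unfolding S_def by (intro sum_nonneg) simp
  have S_pos: "0 < S x" if x: "x \<in> K" for x
  proof -
    obtain y where y: "y \<in> F" "dist y x < r" using F(3) x by auto
    have "(x - y) \<bullet> (x - y) = (dist y x)\<^sup>2"
      by (simp add: dist_norm norm_minus_commute flip: power2_norm_eq_inner)
    also have "\<dots> < r\<^sup>2" using y r by (simp add: power_strict_mono)
    finally show ?thesis
      unfolding S_def using y F(2) by (intro sum_pos2[of _ y]) auto
  qed
  have S_cont: "continuous_on K S" unfolding S_def by (intro continuous_intros)
  obtain c where c: "0 < c" "\<And>x. x \<in> K \<Longrightarrow> c \<le> S x"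
  proof (cases "K = {}")
    case False
    from continuous_attains_inf[OF K False S_cont] S_pos that show thesis by blast
  qed (use that[of 1] in auto)
  have S_deriv: "(S has_derivative (\<lambda>v. H x \<bullet> v)) (at x)" for x
  proof -
    have "((\<lambda>x. (max 0 (r\<^sup>2 - (x - y) \<bullet> (x - y)))\<^sup>2) has_derivative
        (\<lambda>v. ((-4 * max 0 (r\<^sup>2 - (x - y) \<bullet> (x - y))) *\<^sub>R (x - y)) \<bullet> v)) (at x)" for y
    proof -
      have "((\<lambda>x. r\<^sup>2 - (x - y) \<bullet> (x - y)) has_derivative (\<lambda>v. - 2 * ((x - y) \<bullet> v))) (at x)"
        by (auto intro!: derivative_eq_intros simp: fun_eq_iff inner_commute)
      from has_derivative_compose[OF this
          has_real_derivative_max_0_square[unfolded has_field_derivative_def]]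
      show ?thesis by (rule has_derivative_eq_rhs) (simp add: fun_eq_iff)
    qed
    then show ?thesis unfolding S_def H_def inner_sum_left by (intro has_derivative_sum)
  qed
  define \<psi> where "\<psi> = (\<lambda>x. 1 - (max 0 (1 - S x / c))\<^sup>2)"
  define G where "G = (\<lambda>x. (2 * max 0 (1 - S x / c) / c) *\<^sub>R H x)"
  show thesis
  proof
    fix x
    have "((\<lambda>x. 1 - S x / c) has_derivative (\<lambda>v. - (H x \<bullet> v) / c)) (at x)"
      using c(1) by (auto intro!: derivative_eq_intros S_deriv simp: fun_eq_iff)
    from has_derivative_diff[OF has_derivative_const has_derivative_compose[OF this
          has_real_derivative_max_0_square[unfolded has_field_derivative_def]]]
    show "(\<psi> has_derivative (\<lambda>v. G x \<bullet> v)) (at x)"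
      unfolding \<psi>_def G_def by (rule has_derivative_eq_rhs) (simp add: fun_eq_iff)
    show "continuous_on UNIV G"
      using c(1) unfolding G_def H_def S_def by (intro continuous_intros) auto
    have "0 \<le> max 0 (1 - S x / c)" "max 0 (1 - S x / c) \<le> 1"
      using S_nonneg[of x] c(1) by auto
    then show "0 \<le> \<psi> x" "\<psi> x \<le> 1" unfolding \<psi>_def by (auto simp: power_le_one)
    show "\<psi> x = 1" if "x \<in> K"
      using c(2)[OF that] c(1) by (simp add: \<psi>_def max_def)
    show "\<psi> x = 0" if "\<And>y. y \<in> K \<Longrightarrow> r \<le> dist x y"
    proof -
      have "max 0 (r\<^sup>2 - (x - y) \<bullet> (x - y)) = 0" if "y \<in> F" for y
      proof -
        have "r\<^sup>2 \<le> (dist x y)\<^sup>2" using \<open>\<And>y. y \<in> K \<Longrightarrow> r \<le> dist x y\<close> that F(1) r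
          by (intro power_mono) auto
        then show ?thesis by (simp add: dist_norm flip: power2_norm_eq_inner)
      qed
      then have "S x = 0" unfolding S_def by (intro sum.neutral) auto
      then show ?thesis by (simp add: \<psi>_def)
    qed
  qed
qed

section \<open>From integral inequalities to almost every point\<close>

lemma locally_integrable_onD:
  assumes "f locally_integrable_on \<Omega>" "compact K" "K \<subseteq> \<Omega>"
  shows "set_integrable lebesgue K f"
  using assms unfolding locally_integrable_on_def by blast

text \<open>On a compact subset of \<open>{x \<in> \<Omega>. f x < 0}\<close> the integral is both
  nonpositive and nonnegative, so this subset is null. Inner approximation by closed sets then makes
  the whole set null.\<close>

lemma AE_nonneg_if_compact_integrals_nonneg:
  fixes f :: "'a::euclidean_space \<Rightarrow> real"
  assumes \<Omega>: "open \<Omega>" and f: "f locally_integrable_on \<Omega>"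
    and nonneg: "\<And>K. compact K \<Longrightarrow> K \<subseteq> \<Omega> \<Longrightarrow> 0 \<le> (LINT x:K|lebesgue. f x)"
  shows "AE x\<in>\<Omega> in lebesgue. 0 \<le> f x"
proof -
  have null: "K \<in> null_sets lebesgue" if K: "compact K" "K \<subseteq> {x\<in>\<Omega>. f x < 0}" for K
  proof -
    let ?g = "\<lambda>x. indicator K x *\<^sub>R (- f x)"
    have int: "integrable lebesgue ?g"
      using locally_integrable_onD[OF f K(1)] K(2) by (auto simp: set_integrable_def)
    have pos: "AE x in lebesgue. 0 \<le> ?g x"
      using K(2) by (auto simp: indicator_def intro!: always_eventually)
    have "integral\<^sup>L lebesgue ?g = - (LINT x:K|lebesgue. f x)"
      by (simp add: set_lebesgue_integral_def)
    with nonneg[of K] K integral_nonneg_AE[OF pos] have "integral\<^sup>L lebesgue ?g = 0" by auto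
    with integral_nonneg_eq_0_iff_AE[OF int pos] have "AE x in lebesgue. ?g x = 0" by simp
    then have "AE x in lebesgue. x \<notin> K"
      by eventually_elim (use K(2) in \<open>auto simp: indicator_def split: if_splits\<close>)
    moreover have "K \<in> sets lebesgue" using K(1) by (simp add: borel_compact)
    ultimately show ?thesis using AE_iff_null_sets by blast
  qed
  \<comment> \<open>Local integrability gives measurability of \<open>f\<close> only on compact
    sets, so the set where \<open>f\<close> is negative is treated on each \<open>C n\<close>
    separately.\<close>
  obtain C :: "nat \<Rightarrow> 'a set"
    where C: "\<And>n. compact (C n)" "\<And>n. C n \<subseteq> \<Omega>" "\<Union>(range C) = \<Omega>"
    by (rule open_Union_compact_subsets[OF \<Omega>]) (rule that)
  have "AE x in lebesgue. x \<notin> {x \<in> C n. f x < 0}" for n :: nat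
  proof -
    note Cn = C(1,2)[of n]
    have "(\<lambda>x. indicator (C n) x *\<^sub>R f x) \<in> borel_measurable lebesgue"
      using locally_integrable_onD[OF f Cn] by (auto simp: set_integrable_def)
    then have "{x \<in> space lebesgue. indicator (C n) x *\<^sub>R f x < 0} \<in> sets lebesgue"
      by (intro borel_measurable_less) auto
    moreover have "{x \<in> space lebesgue. indicator (C n) x *\<^sub>R f x < 0} = {x \<in> C n. f x < 0}"
      by (auto simp: indicator_def)
    ultimately have "{x \<in> C n. f x < 0} \<in> sets lebesgue" by simp
    \<comment> \<open>Up to a null set, a Lebesgue measurable set is a countable union of closed
      sets; inside \<open>C n\<close> these are compact.\<close>
    then obtain D T where D: "fsigma D" "T \<in> null_sets lebesgue" "D \<union> T = {x \<in> C n. f x < 0}"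
      using lebesgue_set_almost_fsigma by metis
    from D(1) obtain F :: "nat \<Rightarrow> 'a set" where F: "\<And>k. closed (F k)" "D = \<Union>(range F)"
      by (auto elim: fsigma.cases)
    have "F k \<in> null_sets lebesgue" for k
    proof (rule null)
      have "F k \<subseteq> C n" using F(2) D(3) by auto
      then show "compact (F k)" using F(1) Cn(1) by (metis closed_Int_compact inf.absorb1)
      show "F k \<subseteq> {x \<in> \<Omega>. f x < 0}" using F(2) D(3) Cn(2) by auto
    qed
    then have "D \<in> null_sets lebesgue" unfolding F(2) by (intro null_sets_UN) auto
    with D have "{x \<in> C n. f x < 0} \<in> null_sets lebesgue" by (metis null_sets.Un)
    then show ?thesis by (rule AE_not_in)
  qed
  then have "AE x in lebesgue. \<forall>n. x \<notin> {x \<in> C n. f x < 0}" unfolding AE_all_countable by blast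
  then show ?thesis by eventually_elim (use C(3) in \<open>auto simp: not_less\<close>)
qed

text \<open>Cutoffs of shrinking radius converge pointwise to the indicator of \<open>K\<close>.
  Raising them to a power \<open>q > 0\<close> keeps the limit, as 0 and 1 are fixed, and
  \<open>f\<close> restricted to a compact neighbourhood dominates.\<close>

lemma AE_nonneg_if_test_integrals_nonneg:
  fixes f :: "'a::euclidean_space \<Rightarrow> real"
  assumes \<Omega>: "open \<Omega>" and f: "f locally_integrable_on \<Omega>" and q: "0 < q"
    and nonneg: "\<And>\<psi> G L. \<lbrakk>\<And>x. (\<psi> has_derivative (\<lambda>v. G x \<bullet> v)) (at x); continuous_on UNIV G;
      \<And>x. 0 \<le> \<psi> x; compact L; L \<subseteq> \<Omega>; \<And>x. x \<notin> L \<Longrightarrow> \<psi> x = 0\<rbrakk>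
      \<Longrightarrow> 0 \<le> (LINT x:\<Omega>|lebesgue. (\<psi> x powr q) * f x)"
  shows "AE x\<in>\<Omega> in lebesgue. 0 \<le> f x"
proof (rule AE_nonneg_if_compact_integrals_nonneg[OF \<Omega> f])
  fix K assume K: "compact K" "K \<subseteq> \<Omega>"
  show "0 \<le> (LINT x:K|lebesgue. f x)"
  proof (cases "K = {}")
    case False
    obtain e where e: "0 < e" "(\<Union>y\<in>K. cball y e) \<subseteq> \<Omega>"
      using compact_subset_open_imp_cball_epsilon_subset[OF K(1) \<Omega> K(2)] by blast
    \<comment> \<open>The closed \<open>e\<close>-neighbourhood of \<open>K\<close>, a common
      compact set in \<open>\<Omega>\<close> off which all the cutoffs vanish.\<close>
    define L where "L = {x. infdist x K \<le> e}"
    have L: "compact L" unfolding L_def by (rule compact_infdist_le[OF False K(1) e(1)])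
    have L\<Omega>: "L \<subseteq> \<Omega>"
    proof
      fix x assume "x \<in> L"
      obtain y where "y \<in> K" "infdist x K = dist x y"
        using infdist_attains_inf[OF compact_imp_closed[OF K(1)] False] by blast
      with \<open>x \<in> L\<close> have "x \<in> cball y e" by (simp add: L_def dist_commute)
      with \<open>y \<in> K\<close> e(2) show "x \<in> \<Omega>" by blast
    qed
    have "\<exists>\<psi> G. (\<forall>x. (\<psi> has_derivative (\<lambda>v. G x \<bullet> v)) (at x)) \<and> continuous_on UNIV G \<and>
        (\<forall>x. 0 \<le> \<psi> x) \<and> (\<forall>x. \<psi> x \<le> 1) \<and> (\<forall>x\<in>K. \<psi> x = 1) \<and>
        (\<forall>x. e / Suc k \<le> infdist x K \<longrightarrow> \<psi> x = (0::real))" for k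
    proof -
      have "0 < e / Suc k" using e(1) by simp
      from smooth_cutoff[OF K(1) this] obtain \<psi> :: "'a \<Rightarrow> real" and G where *:
        "\<And>x. (\<psi> has_derivative (\<lambda>v. G x \<bullet> v)) (at x)" "continuous_on UNIV G"
        "\<And>x. 0 \<le> \<psi> x" "\<And>x. \<psi> x \<le> 1" "\<And>x. x \<in> K \<Longrightarrow> \<psi> x = 1"
        "\<And>x. (\<And>y. y \<in> K \<Longrightarrow> e / Suc k \<le> dist x y) \<Longrightarrow> \<psi> x = 0" by metis
      have "\<psi> x = 0" if "e / Suc k \<le> infdist x K" for x
        using *(6)[of x] infdist_le that order_trans by metis
      with * show ?thesis by blast
    qed
    then obtain \<psi> G where \<psi>: "\<And>k x. (\<psi> k has_derivative (\<lambda>v. G k x \<bullet> v)) (at x)"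
      "\<And>k. continuous_on UNIV (G k)" "\<And>k x. 0 \<le> \<psi> k x" "\<And>k x. \<psi> k x \<le> 1"
      "\<And>k x. x \<in> K \<Longrightarrow> \<psi> k x = 1" "\<And>k x. e / Suc k \<le> infdist x K \<Longrightarrow> \<psi> k x = (0::real)"
      by metis
    have outside: "\<psi> k x = 0" if "x \<notin> L" for k x
    proof (rule \<psi>(6))
      have "e / Suc k \<le> e" using e(1) by (simp add: field_simps)
      with that show "e / Suc k \<le> infdist x K" by (auto simp: L_def)
    qed
    have fL: "integrable lebesgue (\<lambda>x. indicator L x *\<^sub>R f x)"
      using locally_integrable_onD[OF f L L\<Omega>] by (simp add: set_integrable_def)
    have meas: "(\<lambda>x. indicator \<Omega> x *\<^sub>R ((\<psi> k x powr q) * f x)) \<in> borel_measurable lebesgue" for k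
    proof -
      have "continuous_on UNIV (\<psi> k)"
        using \<psi>(1) by (auto intro!: continuous_at_imp_continuous_on has_derivative_continuous)
      then have "continuous_on UNIV (\<lambda>x. \<psi> k x powr q)"
        using \<psi>(3) q by (intro continuous_on_powr') auto
      then have "(\<lambda>x. \<psi> k x powr q) \<in> borel_measurable lebesgue"
        by (intro measurable_completion) (simp add: borel_measurable_continuous_onI)
      \<comment> \<open>Measurability of \<open>f\<close> is available on \<open>L\<close> only;
        since \<open>\<psi> k\<close> vanishes off \<open>L\<close>, the indicators of
        \<open>L\<close> and \<open>\<Omega>\<close> are interchangeable here.\<close>
      then have "(\<lambda>x. (\<psi> k x powr q) * (indicator L x *\<^sub>R f x)) \<in> borel_measurable lebesgue"
        using fL by (intro borel_measurable_times) auto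
      moreover have "(\<lambda>x. (\<psi> k x powr q) * (indicator L x *\<^sub>R f x)) =
          (\<lambda>x. indicator \<Omega> x *\<^sub>R ((\<psi> k x powr q) * f x))"
        using outside[of _ k] L\<Omega> by (auto simp: fun_eq_iff indicator_def)
      ultimately show ?thesis by simp
    qed
    have "(\<lambda>k. LINT x:\<Omega>|lebesgue. (\<psi> k x powr q) * f x) \<longlonglongrightarrow> (LINT x:K|lebesgue. f x)"
      unfolding set_lebesgue_integral_def
    proof (rule integral_dominated_convergence[where w="\<lambda>x. \<bar>indicator L x *\<^sub>R f x\<bar>"])
      show "(\<lambda>x. indicator K x *\<^sub>R f x) \<in> borel_measurable lebesgue"
        using locally_integrable_onD[OF f K] by (auto simp: set_integrable_def)
      show "integrable lebesgue (\<lambda>x. \<bar>indicator L x *\<^sub>R f x\<bar>)" using fL by simp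
      show "AE x in lebesgue. (\<lambda>k. indicator \<Omega> x *\<^sub>R ((\<psi> k x powr q) * f x)) \<longlonglongrightarrow> indicator K x *\<^sub>R f x"
      proof (intro always_eventually allI)
        fix x
        show "(\<lambda>k. indicator \<Omega> x *\<^sub>R ((\<psi> k x powr q) * f x)) \<longlonglongrightarrow> indicator K x *\<^sub>R f x"
        proof (cases "x \<in> K")
          case True
          then show ?thesis using \<psi>(5) K(2) by (auto simp: indicator_def)
        next
          case nx: False
          have "0 < infdist x K"
            using nx False K(1) by (simp add: compact_imp_closed infdist_pos_not_in_closed)
          moreover have "(\<lambda>k. e / Suc k) \<longlonglongrightarrow> 0"
            by (rule LIMSEQ_Suc) (rule lim_const_over_n)
          ultimately have "eventually (\<lambda>k. e / Suc k < infdist x K) sequentially"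
            using order_tendstoD(2) by blast
          then have "eventually (\<lambda>k. \<psi> k x = 0) sequentially"
            by eventually_elim (simp add: \<psi>(6))
          then have "eventually (\<lambda>k. indicator \<Omega> x *\<^sub>R ((\<psi> k x powr q) * f x) = indicator K x *\<^sub>R f x) sequentially"
            by eventually_elim (use nx in simp)
          then show ?thesis by (rule tendsto_eventually)
        qed
      qed
      fix k
      show "AE x in lebesgue. norm (indicator \<Omega> x *\<^sub>R ((\<psi> k x powr q) * f x)) \<le> \<bar>indicator L x *\<^sub>R f x\<bar>"
      proof (intro always_eventually allI)
        fix x
        have "\<psi> k x powr q \<le> 1" using \<psi>(3,4) q powr_le_one_le by (simp add: powr_le1)
        then show "norm (indicator \<Omega> x *\<^sub>R ((\<psi> k x powr q) * f x)) \<le> \<bar>indicator L x *\<^sub>R f x\<bar>"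
          using outside[of x k] mult_right_mono[of "\<psi> k x powr q" 1 "\<bar>f x\<bar>"]
          by (auto simp: indicator_def abs_mult)
      qed
    qed (rule meas)
    moreover have "0 \<le> (LINT x:\<Omega>|lebesgue. (\<psi> k x powr q) * f x)" for k
      using nonneg[OF \<psi>(1,2,3) L L\<Omega> outside] .
    ultimately show ?thesis using LIMSEQ_le_const by blast
  qed (simp add: set_lebesgue_integral_def)
qed

section \<open>Oscillating test functions\<close>

text \<open>The coefficients \<open>c n\<close> need not converge, so continuity at one point does
  not suffice. All arguments stay in one compact set, on which \<open>\<Phi>\<close> is uniformly
  continuous, and homogeneity extracts \<open>(c n)\<^sup>2\<close>.\<close>

lemma oscillating_quadratic_limit:
  fixes \<Phi> :: "'a::euclidean_space \<times> 'b::euclidean_space \<Rightarrow> 'c::real_normed_vector"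
  assumes cont: "continuous_on UNIV \<Phi>"
    and quad: "\<And>z c \<xi>. \<Phi> (z, c *\<^sub>R \<xi>) = c\<^sup>2 *\<^sub>R \<Phi> (z, \<xi>)"
    and z: "z \<longlonglongrightarrow> z0" and e: "e \<longlonglongrightarrow> 0" and c: "\<And>n. \<bar>c n\<bar> \<le> 1"
  shows "(\<lambda>n. \<Phi> (z n, c n *\<^sub>R a + e n) - (c n)\<^sup>2 *\<^sub>R \<Phi> (z0, a)) \<longlonglongrightarrow> 0"
proof -
  obtain Z where Z: "\<And>n. norm (z n) \<le> Z"
    using convergent_imp_bounded[OF z] by (auto simp: bounded_iff)
  obtain E where E: "\<And>n. norm (e n) \<le> E"
    using convergent_imp_bounded[OF e] by (auto simp: bounded_iff)
  define S where "S = cball (0::'a) (max Z (norm z0)) \<times> cball (0::'b) (norm a + E)"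
  have "compact S" unfolding S_def by (intro compact_Times compact_cball)
  then have uc: "uniformly_continuous_on S \<Phi>"
    using cont continuous_on_subset compact_uniformly_continuous by blast
  have ca: "norm (c n *\<^sub>R a) \<le> norm a" for n
    using mult_right_mono[OF c[of n], of "norm a"] by simp
  have E0: "0 \<le> E" using E[of 0] norm_ge_zero order_trans by blast
  have 1: "(z n, c n *\<^sub>R a + e n) \<in> S" for n
    unfolding S_def using Z[of n] norm_triangle_ineq[of "c n *\<^sub>R a" "e n"] ca[of n] E[of n] by simp
  have 2: "(z0, c n *\<^sub>R a) \<in> S" for n
    unfolding S_def using ca[of n] E0 by simp
  have "(\<lambda>n. (z n - z0, e n)) \<longlonglongrightarrow> (z0 - z0, 0)" by (intro tendsto_intros z e)
  then have "(\<lambda>n. norm (z n - z0, e n)) \<longlonglongrightarrow> 0" by (simp add: tendsto_norm_zero flip: zero_prod_def)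
  then have "(\<lambda>n. dist (z n, c n *\<^sub>R a + e n) (z0, c n *\<^sub>R a)) \<longlonglongrightarrow> 0"
    by (simp add: dist_norm)
  then have "(\<lambda>n. dist (\<Phi> (z n, c n *\<^sub>R a + e n)) (\<Phi> (z0, c n *\<^sub>R a))) \<longlonglongrightarrow> 0"
    using uc[unfolded uniformly_continuous_on_sequentially, rule_format,
        of "\<lambda>n. (z n, c n *\<^sub>R a + e n)" "\<lambda>n. (z0, c n *\<^sub>R a)"] 1 2 by simp
  then show ?thesis unfolding quad dist_norm by (rule tendsto_norm_zero_cancel)
qed

lemma continuous_on_herm_inner_matrix [continuous_intros]:
  assumes "continuous_on S f" "continuous_on S g"
  shows "continuous_on S (\<lambda>x. herm_inner (M *v f x) (g x))"
  unfolding herm_inner_matrix_vector_mult by (intro continuous_intros assms)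

lemma borel_measurable_herm_inner_matrix:
  fixes M :: "'a::euclidean_space \<Rightarrow> complex ^ 'm ^ 'm"
  assumes M: "\<And>i j. (\<lambda>x. indicator L x *\<^sub>R M x $ i $ j) \<in> borel_measurable lebesgue"
    and f: "continuous_on UNIV f" and g: "continuous_on UNIV g"
  shows "(\<lambda>x. indicator L x *\<^sub>R herm_inner (M x *v f x) (g x)) \<in> borel_measurable lebesgue"
proof -
  have "(\<lambda>x. f x $ j * cnj (g x $ i)) \<in> borel_measurable lebesgue" for i j
    by (intro measurable_completion)
      (simp, intro borel_measurable_continuous_onI continuous_intros f g)
  then have "(\<lambda>x. (indicator L x *\<^sub>R M x $ i $ j) * (f x $ j * cnj (g x $ i))) \<in> borel_measurable lebesgue" for i j
    by (rule borel_measurable_times[OF M])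
  then have "(\<lambda>x. \<Sum>i\<in>UNIV. \<Sum>j\<in>UNIV. (indicator L x *\<^sub>R M x $ i $ j) * (f x $ j * cnj (g x $ i)))
      \<in> borel_measurable lebesgue"
    by (intro borel_measurable_sum)
  then show ?thesis by (simp add: herm_inner_matrix_vector_mult scaleR_sum_right)
qed

text \<open>In finite dimension, continuity of the derivative applied to each fixed vector already
  gives continuity in operator norm.\<close>

lemma C1_compact_supportI:
  fixes u :: "real ^ 'n \<Rightarrow> 'b::real_normed_vector"
  assumes u: "\<And>x. (u has_derivative U x) (at x)"
    and U: "\<And>v. continuous_on UNIV (\<lambda>x. U x v)"
    and L: "compact L" "L \<subseteq> \<Omega>" "\<And>x. x \<notin> L \<Longrightarrow> u x = 0"
  shows "u \<in> C1_compact_support \<Omega>"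
proof -
  have bl: "blinfun_apply (Blinfun (U x)) = U x" for x
    using has_derivative_bounded_linear[OF u] by (rule bounded_linear_Blinfun_apply)
  have "continuous_on UNIV (\<lambda>x. Blinfun (U x))"
    by (rule continuous_on_blinfun_componentwise) (simp add: bl U)
  then have 1: "continuous_on \<Omega> (\<lambda>x. Blinfun (U x))" by (rule continuous_on_subset) simp
  have "support_on \<Omega> u \<subseteq> L" using L(3) by (auto simp: support_on_def)
  then have 2: "closure (support_on \<Omega> u) \<subseteq> L"
    using L(1) by (simp add: closure_minimal compact_imp_closed)
  then have 3: "compact (closure (support_on \<Omega> u))"
    using L(1) by (metis closed_closure closed_Int_compact inf.absorb1)
  show ?thesis
    unfolding C1_compact_support_def
    using u bl 1 2 3 L(2) by (auto intro!: exI[of _ "\<lambda>x. Blinfun (U x)"])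
qed

text \<open>
  The test functions are \<open>\<psi> (\<omega> + sin (n\<^sup>2 x\<^sub>h + \<theta>) \<mu> / n)\<close>. The amplitude tends to \<open>0\<close>, but the
  derivative in direction \<open>h\<close> is of order \<open>n\<close> and those in the other directions are bounded, so
  that after division by \<open>n\<^sup>2\<close> only direction \<open>h\<close> survives. Adding the phases \<open>\<theta> = 0\<close> and
  \<open>\<theta> = \<pi> / 2\<close> removes the oscillation by \<open>cos\<^sup>2 + sin\<^sup>2 = 1\<close>, which gives pointwise convergence.
\<close>
lemma oscillating_test_functions:
  fixes A :: "'n \<Rightarrow> real ^ 'n \<Rightarrow> complex ^ 'm ^ 'm" and \<psi> :: "real ^ 'n \<Rightarrow> real"
  assumes p: "2 \<le> p"
    and A: "\<And>h i j. (\<lambda>x. A h x $ i $ j) locally_integrable_on \<Omega>"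
    and diss: "Lp_dissipative p \<Omega> A"
    and \<psi>: "\<And>x. (\<psi> has_derivative (\<lambda>v. G x \<bullet> v)) (at x)" and G: "continuous_on UNIV G"
    and \<psi>_nonneg: "\<And>x. 0 \<le> \<psi> x"
    and L: "compact L" "L \<subseteq> \<Omega>" and \<psi>_0: "\<And>x. x \<notin> L \<Longrightarrow> \<psi> x = 0"
  shows "0 \<le> (LINT x:\<Omega>|lebesgue. (\<psi> x powr p) *
    Re (herm_inner (A h x *v \<mu>) (powr_scale_deriv (p - 2) \<omega> \<mu>)))"
proof -
  \<comment> \<open>The frequency parameter is shifted by one to avoid division by 0.\<close>
  define a where "a = (\<lambda>n. real (Suc n))"
  define \<phi> where "\<phi> = (\<lambda>\<theta> n (x :: real ^ 'n). (a n)\<^sup>2 * x $ h + \<theta>)"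
  define w where "w = (\<lambda>\<theta> n x. \<omega> + (sin (\<phi> \<theta> n x) / a n) *\<^sub>R \<mu>)"
  define u where "u = (\<lambda>\<theta> n x. \<psi> x *\<^sub>R w \<theta> n x)"
  \<comment> \<open>The partial derivative of \<open>u \<theta> n\<close> in direction
    \<open>k\<close>, divided by \<open>a n\<close>: an oscillating term present only for
    \<open>k = h\<close>, plus an error of order \<open>1 / a n\<close>.\<close>
  define \<xi> where "\<xi> = (\<lambda>\<theta> n k x. (if k = h then cos (\<phi> \<theta> n x) else 0) *\<^sub>R (\<psi> x *\<^sub>R \<mu>) + (G x $ k / a n) *\<^sub>R w \<theta> n x)"
  define \<Phi> where "\<Phi> = (\<lambda>k x (z, \<xi>). herm_inner (A k x *v \<xi>) (powr_scale_deriv (p - 2) z \<xi>))"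
  \<comment> \<open>The integrand of the sesquilinear form divided by \<open>(a n)\<^sup>2\<close>,
    because both gradients in it are divided by \<open>a n\<close>.\<close>
  define W where "W = (\<lambda>\<theta> n x. \<Sum>k\<in>UNIV. \<Phi> k x (u \<theta> n x, \<xi> \<theta> n k x))"
  have a: "1 \<le> a n" for n by (simp add: a_def)
  have a0: "a n \<noteq> 0" for n by (simp add: a_def)
  have a_inv: "(\<lambda>n. inverse (a n)) \<longlonglongrightarrow> 0"
    unfolding a_def by (rule LIMSEQ_inverse_real_of_nat)
  have quad: "\<Phi> k x (z, c *\<^sub>R \<xi>) = c\<^sup>2 *\<^sub>R \<Phi> k x (z, \<xi>)" for k x z c \<xi>
    by (simp add: \<Phi>_def power2_eq_square)
  have \<Phi>_cont: "continuous_on UNIV (\<Phi> k x)" for k x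
    unfolding \<Phi>_def case_prod_unfold using p by (intro continuous_intros) auto
  have \<psi>_cont: "continuous_on UNIV \<psi>"
    using \<psi> by (auto intro!: continuous_at_imp_continuous_on has_derivative_continuous)
  have \<phi>_cont: "continuous_on UNIV (\<phi> \<theta> n)" for \<theta> n
    unfolding \<phi>_def by (intro continuous_intros)
  have w_cont: "continuous_on UNIV (w \<theta> n)" for \<theta> n
    unfolding w_def using a0 by (intro continuous_intros \<phi>_cont) auto
  have u_cont: "continuous_on UNIV (u \<theta> n)" for \<theta> n
    unfolding u_def by (intro continuous_intros \<psi>_cont w_cont)
  have \<xi>_cont: "continuous_on UNIV (\<xi> \<theta> n k)" for \<theta> n k
    unfolding \<xi>_def using a0
    by (cases "k = h") (auto intro!: continuous_intros \<psi>_cont w_cont G \<phi>_cont)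
  \<comment> \<open>Off \<open>L\<close> the nonnegative function \<open>\<psi>\<close> attains its
    minimum 0, so its gradient vanishes.\<close>
  have G_0: "G x = 0" if "x \<notin> L" for x
  proof -
    have "(\<lambda>v. G x \<bullet> v) = (\<lambda>v. 0)"
      by (rule differential_zero_maxmin[of x UNIV \<psi>]) (use \<psi> \<psi>_nonneg \<psi>_0 that in auto)
    then show ?thesis by (metis inner_eq_zero_iff)
  qed
  have \<xi>_0: "\<xi> \<theta> n k x = 0" if "x \<notin> L" for \<theta> n k x
    using that by (simp add: \<xi>_def G_0 \<psi>_0)
  have W_0: "W \<theta> n x = 0" if "x \<notin> L" for \<theta> n x
    using quad[of _ x _ 0 0] by (simp add: W_def \<xi>_0[OF that])

  define U where "U = (\<lambda>\<theta> n x v. (G x \<bullet> v) *\<^sub>R w \<theta> n x + (\<psi> x * (a n * cos (\<phi> \<theta> n x) * v $ h)) *\<^sub>R \<mu>)"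
  have u_deriv: "(u \<theta> n has_derivative U \<theta> n x) (at x)" for \<theta> n x
  proof -
    have "((\<lambda>x. x $ h) has_derivative (\<lambda>v. v $ h)) (at x)"
      by (rule bounded_linear_imp_has_derivative) (rule bounded_linear_vec_nth)
    then have "(\<phi> \<theta> n has_derivative (\<lambda>v. (a n)\<^sup>2 * v $ h)) (at x)"
      unfolding \<phi>_def by (auto intro!: derivative_eq_intros)
    then have "((\<lambda>x. sin (\<phi> \<theta> n x) / a n) has_derivative (\<lambda>v. a n * cos (\<phi> \<theta> n x) * v $ h)) (at x)"
      using a0[of n] by (auto intro!: derivative_eq_intros simp: fun_eq_iff power2_eq_square)
    from has_derivative_add[OF has_derivative_const has_derivative_scaleR_left[OF this]]
    have "(w \<theta> n has_derivative (\<lambda>v. (a n * cos (\<phi> \<theta> n x) * v $ h) *\<^sub>R \<mu>)) (at x)"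
      unfolding w_def by simp
    from has_derivative_scaleR[OF \<psi> this] show ?thesis
      unfolding u_def U_def by (rule has_derivative_eq_rhs) (simp add: fun_eq_iff add.commute)
  qed
  have partial: "partial_deriv k (u \<theta> n) x = a n *\<^sub>R \<xi> \<theta> n k x" for \<theta> n k x
  proof -
    have "G x \<bullet> axis k 1 = G x $ k" by (simp add: inner_axis)
    moreover have "(axis k 1 :: real ^ 'n) $ h = (if k = h then 1 else 0)" by (auto simp: axis_def)
    ultimately show ?thesis
      using a0[of n] by (simp add: partial_deriv_eq[OF u_deriv] U_def \<xi>_def scaleR_add_right)
  qed
  have uC1: "u \<theta> n \<in> C1_compact_support \<Omega>" for \<theta> n
  proof (rule C1_compact_supportI[OF u_deriv _ L])
    show "continuous_on UNIV (\<lambda>x. U \<theta> n x v)" for v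
      unfolding U_def by (intro continuous_intros G w_cont \<psi>_cont \<phi>_cont)
  qed (simp add: u_def \<psi>_0)
  have W_nonneg: "0 \<le> Re (LINT x:\<Omega>|lebesgue. W \<theta> n x)" for \<theta> n
  proof -
    have "sesq_form \<Omega> A (u \<theta> n) (norm_powr_scale (p - 2) (u \<theta> n)) =
        (LINT x:\<Omega>|lebesgue. (a n)\<^sup>2 *\<^sub>R W \<theta> n x)"
      using p unfolding sesq_form_def
      by (simp add: partial_deriv_norm_powr_scale[OF _ u_deriv] partial W_def \<Phi>_def
          scaleR_sum_right power2_eq_square)
    also have "\<dots> = (a n)\<^sup>2 *\<^sub>R (LINT x:\<Omega>|lebesgue. W \<theta> n x)"
      by (rule set_integral_scaleR_right)
    finally have "0 \<le> (a n)\<^sup>2 * Re (LINT x:\<Omega>|lebesgue. W \<theta> n x)"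
      using diss uC1[of \<theta> n] p unfolding Lp_dissipative_def by auto
    then show ?thesis using a0[of n] by (simp add: zero_le_mult_iff)
  qed

  \<comment> \<open>Bounds uniform in \<open>n\<close> and \<open>\<theta>\<close> follow: on
    \<open>L\<close>, \<open>u\<close> and \<open>\<xi>\<close> stay in fixed balls, which leads to
    the integrable majorant \<open>M\<close>.\<close>
  obtain B1 where B1: "\<forall>x\<in>L. \<bar>\<psi> x\<bar> \<le> B1" "0 < B1"
    using compact_imp_bounded[OF compact_continuous_image[OF continuous_on_subset[OF \<psi>_cont] L(1)]]
    by (auto simp: bounded_pos)
  obtain B2 where B2: "\<forall>x\<in>L. norm (G x) \<le> B2" "0 < B2"
    using compact_imp_bounded[OF compact_continuous_image[OF continuous_on_subset[OF G] L(1)]]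
    by (auto simp: bounded_pos)
  define N where "N = norm \<omega> + norm \<mu>"
  have N: "0 \<le> N" by (simp add: N_def)
  have w_le: "norm (w \<theta> n x) \<le> N" for \<theta> n x
  proof -
    have "\<bar>sin (\<phi> \<theta> n x)\<bar> / a n \<le> 1 / 1"
      using a[of n] by (intro frac_le) auto
    then have "norm ((sin (\<phi> \<theta> n x) / a n) *\<^sub>R \<mu>) \<le> norm \<mu>"
      using a[of n] mult_right_mono[of "\<bar>sin (\<phi> \<theta> n x)\<bar> / a n" 1 "norm \<mu>"] by simp
    then show ?thesis unfolding w_def N_def by (intro norm_triangle_le) simp
  qed
  have u_le: "norm (u \<theta> n x) \<le> B1 * N" if "x \<in> L" for \<theta> n x
    unfolding u_def norm_scaleR using B1 that w_le by (intro mult_mono) auto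
  define B where "B = B1 * norm \<mu> + B2 * N"
  have \<xi>_le: "norm (\<xi> \<theta> n k x) \<le> B" if x: "x \<in> L" for \<theta> n k x
    unfolding \<xi>_def B_def
  proof (intro norm_triangle_mono)
    have "\<bar>if k = h then cos (\<phi> \<theta> n x) else 0\<bar> * (\<bar>\<psi> x\<bar> * norm \<mu>) \<le> 1 * (B1 * norm \<mu>)"
      using B1 x by (intro mult_mono) auto
    then show "norm ((if k = h then cos (\<phi> \<theta> n x) else 0) *\<^sub>R (\<psi> x *\<^sub>R \<mu>)) \<le> B1 * norm \<mu>"
      by (simp only: norm_scaleR real_norm_def mult_1)
    have "\<bar>G x $ k\<bar> \<le> B2"
      using bspec[OF B2(1) x] component_le_norm_cart[of "G x" k] by simp
    then have "\<bar>G x $ k\<bar> / a n \<le> B2 / 1"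
      using a[of n] B2 by (intro frac_le) auto
    then have "\<bar>G x $ k\<bar> / a n * norm (w \<theta> n x) \<le> B2 * N"
      using w_le B2(2) N by (intro mult_mono) auto
    then show "norm ((G x $ k / a n) *\<^sub>R w \<theta> n x) \<le> B2 * N" using a[of n] by simp
  qed
  have "compact ((\<lambda>y. powr_scale_deriv (p - 2) (fst y) (snd y)) `
      (cball (0 :: complex ^ 'm) (B1 * N) \<times> cball (0 :: complex ^ 'm) B))"
    using p by (intro compact_continuous_image compact_Times compact_cball continuous_intros) auto
  then obtain D where D: "\<And>z \<xi> :: complex ^ 'm. norm z \<le> B1 * N \<Longrightarrow> norm \<xi> \<le> B \<Longrightarrow>
      norm (powr_scale_deriv (p - 2) z \<xi>) \<le> D"
    by (force dest!: compact_imp_bounded simp: bounded_iff)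
  define M where "M = (\<lambda>x. indicator L x *\<^sub>R ((\<Sum>k\<in>UNIV. \<Sum>i\<in>UNIV. \<Sum>j\<in>UNIV. norm (A k x $ i $ j)) * (B * D)))"
  have A_int: "integrable lebesgue (\<lambda>x. indicator L x *\<^sub>R A k x $ i $ j)" for k i j
    using locally_integrable_onD[OF A L] by (simp add: set_integrable_def)
  have M_int: "integrable lebesgue M"
  proof -
    have "integrable lebesgue (\<lambda>x. (\<Sum>k\<in>UNIV. \<Sum>i\<in>UNIV. \<Sum>j\<in>UNIV. norm (indicator L x *\<^sub>R A k x $ i $ j)) * (B * D))"
      by (intro integrable_mult_left Bochner_Integration.integrable_sum integrable_norm A_int)
    moreover have "(\<lambda>x. (\<Sum>k\<in>UNIV. \<Sum>i\<in>UNIV. \<Sum>j\<in>UNIV. norm (indicator L x *\<^sub>R A k x $ i $ j)) * (B * D)) = M"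
      unfolding M_def by (auto simp: fun_eq_iff indicator_def)
    ultimately show ?thesis by (simp only:)
  qed
  have W_le: "norm (indicator \<Omega> x *\<^sub>R W \<theta> n x) \<le> M x" for \<theta> n x
  proof (cases "x \<in> L")
    case True
    have B0: "0 \<le> B" using \<xi>_le[OF True, of 0 0 h] norm_ge_zero order_trans by blast
    have "norm (\<Phi> k x (u \<theta> n x, \<xi> \<theta> n k x)) \<le> (\<Sum>i\<in>UNIV. \<Sum>j\<in>UNIV. norm (A k x $ i $ j)) * (B * D)" for k
    proof -
      have "norm (\<Phi> k x (u \<theta> n x, \<xi> \<theta> n k x)) \<le> (\<Sum>i\<in>UNIV. \<Sum>j\<in>UNIV. norm (A k x $ i $ j)) *
          (norm (\<xi> \<theta> n k x) * norm (powr_scale_deriv (p - 2) (u \<theta> n x) (\<xi> \<theta> n k x)))"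
        unfolding \<Phi>_def prod.case by (rule norm_herm_inner_matrix_le)
      also have "\<dots> \<le> (\<Sum>i\<in>UNIV. \<Sum>j\<in>UNIV. norm (A k x $ i $ j)) * (B * D)"
        using True B0 by (intro mult_left_mono mult_mono D u_le \<xi>_le sum_nonneg) auto
      finally show ?thesis .
    qed
    then have "norm (W \<theta> n x) \<le> (\<Sum>k\<in>UNIV. (\<Sum>i\<in>UNIV. \<Sum>j\<in>UNIV. norm (A k x $ i $ j)) * (B * D))"
      unfolding W_def by (intro sum_norm_le) auto
    then show ?thesis using True L(2) by (auto simp: M_def sum_distrib_right)
  qed (simp add: W_0 M_def)
  have W_meas: "(\<lambda>x. indicator \<Omega> x *\<^sub>R W \<theta> n x) \<in> borel_measurable lebesgue" for \<theta> n
  proof -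
    have "(\<lambda>x. \<Sum>k\<in>UNIV. indicator L x *\<^sub>R \<Phi> k x (u \<theta> n x, \<xi> \<theta> n k x)) \<in> borel_measurable lebesgue"
      unfolding \<Phi>_def prod.case using p
      by (intro borel_measurable_sum borel_measurable_herm_inner_matrix borel_measurable_integrable A_int
          continuous_intros u_cont \<xi>_cont) auto
    moreover have "(\<lambda>x. \<Sum>k\<in>UNIV. indicator L x *\<^sub>R \<Phi> k x (u \<theta> n x, \<xi> \<theta> n k x)) = (\<lambda>x. indicator \<Omega> x *\<^sub>R W \<theta> n x)"
      using W_0[of _ \<theta> n] L(2) by (auto simp: fun_eq_iff indicator_def W_def)
    ultimately show ?thesis by simp
  qed
  have W_int: "integrable lebesgue (\<lambda>x. indicator \<Omega> x *\<^sub>R W \<theta> n x)" for \<theta> n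
    by (rule Bochner_Integration.integrable_bound[OF M_int W_meas])
      (intro always_eventually allI order_trans[OF W_le], simp)

  define F where "F = (\<lambda>x. \<Phi> h x (\<psi> x *\<^sub>R \<omega>, \<psi> x *\<^sub>R \<mu>))"
  \<comment> \<open>Two powers of \<open>\<psi> x\<close> come from the quadratic dependence on the
    direction, the other \<open>p - 2\<close> from the homogeneity in the base point.\<close>
  have F_eq: "F x = (\<psi> x powr p) *\<^sub>R \<Phi> h x (\<omega>, \<mu>)" for x
  proof (cases "\<psi> x = 0")
    case False
    then have pos: "0 < \<psi> x" using \<psi>_nonneg[of x] by simp
    have "\<psi> x powr p = (\<psi> x)\<^sup>2 * \<psi> x powr (p - 2)"
      using pos by (simp add: powr_diff)
    moreover have "\<Phi> h x (\<psi> x *\<^sub>R \<omega>, \<mu>) = (\<psi> x powr (p - 2)) *\<^sub>R \<Phi> h x (\<omega>, \<mu>)"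
      by (simp add: \<Phi>_def powr_scale_deriv_scaleR_base[OF pos])
    ultimately show ?thesis unfolding F_def quad by simp
  qed (use quad[of h x 0 0 \<mu>] in \<open>simp add: F_def\<close>)
  have W_lim: "(\<lambda>n. W 0 n x + W (pi / 2) n x) \<longlonglongrightarrow> F x" for x
  proof -
    have sin_0: "(\<lambda>n. (sin (\<phi> \<theta> n x) / a n) *\<^sub>R \<mu>) \<longlonglongrightarrow> 0" for \<theta>
    proof -
      have "(\<lambda>n. sin (\<phi> \<theta> n x) / a n) \<longlonglongrightarrow> 0"
        by (rule Lim_null_comparison[OF _ a_inv])
          (use a in \<open>auto intro!: always_eventually simp: divide_simps a_def\<close>)
      from tendsto_scaleR[OF this tendsto_const] show ?thesis by simp
    qed
    have w_lim: "(\<lambda>n. w \<theta> n x) \<longlonglongrightarrow> \<omega>" for \<theta>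
      using tendsto_add[OF tendsto_const sin_0, of \<omega>] unfolding w_def by simp
    have u_lim: "(\<lambda>n. u \<theta> n x) \<longlonglongrightarrow> \<psi> x *\<^sub>R \<omega>" for \<theta>
      unfolding u_def by (intro tendsto_intros w_lim)
    have e_lim: "(\<lambda>n. (G x $ k / a n) *\<^sub>R w \<theta> n x) \<longlonglongrightarrow> 0" for k \<theta>
    proof -
      have "(\<lambda>n. (G x $ k * inverse (a n)) *\<^sub>R w \<theta> n x) \<longlonglongrightarrow> (G x $ k * 0) *\<^sub>R \<omega>"
        by (intro tendsto_intros w_lim a_inv)
      then show ?thesis by (simp add: divide_inverse)
    qed
    \<comment> \<open>The coefficient of the oscillating term; being 0 for
      \<open>k \<noteq> h\<close>, it removes every other direction in the limit.\<close>
    define c where "c = (\<lambda>\<theta> n k. if k = h then cos (\<phi> \<theta> n x) else 0)"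
    have "(\<lambda>n. \<Phi> k x (u \<theta> n x, \<xi> \<theta> n k x) - (c \<theta> n k)\<^sup>2 *\<^sub>R \<Phi> k x (\<psi> x *\<^sub>R \<omega>, \<psi> x *\<^sub>R \<mu>)) \<longlonglongrightarrow> 0" for k \<theta>
      unfolding \<xi>_def c_def
      by (rule oscillating_quadratic_limit[OF \<Phi>_cont quad u_lim e_lim]) auto
    then have "(\<lambda>n. \<Sum>k\<in>UNIV. \<Phi> k x (u \<theta> n x, \<xi> \<theta> n k x) - (c \<theta> n k)\<^sup>2 *\<^sub>R \<Phi> k x (\<psi> x *\<^sub>R \<omega>, \<psi> x *\<^sub>R \<mu>)) \<longlonglongrightarrow> 0" for \<theta>
      by (intro tendsto_null_sum) auto
    moreover have "(\<Sum>k\<in>UNIV. (c \<theta> n k)\<^sup>2 *\<^sub>R \<Phi> k x (\<psi> x *\<^sub>R \<omega>, \<psi> x *\<^sub>R \<mu>)) = (cos (\<phi> \<theta> n x))\<^sup>2 *\<^sub>R F x" for \<theta> n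
    proof -
      have "(\<Sum>k\<in>UNIV. (c \<theta> n k)\<^sup>2 *\<^sub>R \<Phi> k x (\<psi> x *\<^sub>R \<omega>, \<psi> x *\<^sub>R \<mu>)) =
          (\<Sum>k\<in>UNIV. if k = h then (cos (\<phi> \<theta> n x))\<^sup>2 *\<^sub>R F x else 0)"
        by (intro sum.cong) (auto simp: c_def F_def)
      then show ?thesis by simp
    qed
    ultimately have "(\<lambda>n. W \<theta> n x - (cos (\<phi> \<theta> n x))\<^sup>2 *\<^sub>R F x) \<longlonglongrightarrow> 0" for \<theta>
      by (simp add: W_def sum_subtractf)
    from tendsto_add[OF this[of 0] this[of "pi / 2"]]
    have "(\<lambda>n. (W 0 n x + W (pi / 2) n x) -
        ((cos (\<phi> 0 n x))\<^sup>2 + (cos (\<phi> (pi / 2) n x))\<^sup>2) *\<^sub>R F x) \<longlonglongrightarrow> 0"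
      by (simp add: algebra_simps)
    moreover have "(cos (\<phi> 0 n x))\<^sup>2 + (cos (\<phi> (pi / 2) n x))\<^sup>2 = 1" for n
      by (simp add: \<phi>_def cos_add)
    ultimately show ?thesis by (simp add: Lim_null[of _ "F x"])
  qed
  have V_meas: "(\<lambda>x. indicator \<Omega> x *\<^sub>R W 0 n x + indicator \<Omega> x *\<^sub>R W (pi / 2) n x) \<in> borel_measurable lebesgue" for n
    by (intro borel_measurable_add W_meas)
  have V_lim: "(\<lambda>n. indicator \<Omega> x *\<^sub>R W 0 n x + indicator \<Omega> x *\<^sub>R W (pi / 2) n x) \<longlonglongrightarrow> indicator \<Omega> x *\<^sub>R F x" for x
    unfolding scaleR_add_right[symmetric] by (intro tendsto_intros W_lim)
  have F_meas: "(\<lambda>x. indicator \<Omega> x *\<^sub>R F x) \<in> borel_measurable lebesgue"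
    by (rule borel_measurable_LIMSEQ_metric[OF V_meas V_lim])
  have V_lim: "AE x in lebesgue. (\<lambda>n. indicator \<Omega> x *\<^sub>R W 0 n x + indicator \<Omega> x *\<^sub>R W (pi / 2) n x)
      \<longlonglongrightarrow> indicator \<Omega> x *\<^sub>R F x"
    using V_lim by simp
  have V_le: "AE x in lebesgue. norm (indicator \<Omega> x *\<^sub>R W 0 n x + indicator \<Omega> x *\<^sub>R W (pi / 2) n x) \<le> 2 * M x" for n
  proof (intro always_eventually allI)
    fix x
    show "norm (indicator \<Omega> x *\<^sub>R W 0 n x + indicator \<Omega> x *\<^sub>R W (pi / 2) n x) \<le> 2 * M x"
      using norm_triangle_mono[OF W_le[of x 0 n] W_le[of x "pi / 2" n]] by simp
  qed
  have M2_int: "integrable lebesgue (\<lambda>x. 2 * M x)" using M_int by simp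
  note F_int = integrable_dominated_convergence[OF F_meas V_meas M2_int V_lim V_le]
  note F_lim = integral_dominated_convergence[OF F_meas V_meas M2_int V_lim V_le]
  have "0 \<le> Re (LINT x|lebesgue. indicator \<Omega> x *\<^sub>R W 0 n x + indicator \<Omega> x *\<^sub>R W (pi / 2) n x)" for n
    using W_nonneg[of 0 n] W_nonneg[of "pi / 2" n]
    unfolding set_lebesgue_integral_def by (subst Bochner_Integration.integral_add[OF W_int W_int]) simp
  with tendsto_Re[OF F_lim] have "0 \<le> Re (LINT x|lebesgue. indicator \<Omega> x *\<^sub>R F x)"
    using LIMSEQ_le_const by blast
  also have "\<dots> = (LINT x|lebesgue. Re (indicator \<Omega> x *\<^sub>R F x))"
    by (rule integral_Re[OF F_int, symmetric])
  finally show ?thesis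
    by (simp add: set_lebesgue_integral_def F_eq \<Phi>_def mult.assoc)
qed

section \<open>Necessity for \<open>p \<ge> 2\<close>\<close>

lemma locally_integrable_on_herm_inner_matrix:
  fixes M :: "'a::euclidean_space \<Rightarrow> complex ^ 'm ^ 'm"
  assumes "\<And>i j. (\<lambda>x. M x $ i $ j) locally_integrable_on \<Omega>"
  shows "(\<lambda>x. Re (herm_inner (M x *v u) v)) locally_integrable_on \<Omega>"
  unfolding locally_integrable_on_def set_integrable_def
proof (intro allI impI)
  fix K assume K: "compact K \<and> K \<subseteq> \<Omega>"
  have "integrable lebesgue (\<lambda>x. \<Sum>i\<in>UNIV. \<Sum>j\<in>UNIV. (indicator K x *\<^sub>R M x $ i $ j) * (u $ j * cnj (v $ i)))"
    using assms K unfolding locally_integrable_on_def set_integrable_def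
    by (intro Bochner_Integration.integrable_sum integrable_mult_left) auto
  then have "integrable lebesgue (\<lambda>x. indicator K x *\<^sub>R herm_inner (M x *v u) v)"
    by (simp add: herm_inner_matrix_vector_mult scaleR_sum_right)
  from integrable_Re[OF this]
  show "integrable lebesgue (\<lambda>x. indicator K x *\<^sub>R Re (herm_inner (M x *v u) v))" by simp
qed

lemma nonneg_if_nonneg_on_dense:
  fixes f :: "'a::topological_space \<Rightarrow> real"
  assumes f: "continuous_on UNIV f" and D: "\<And>U. open U \<Longrightarrow> U \<noteq> {} \<Longrightarrow> \<exists>d\<in>D. d \<in> U"
    and nonneg: "\<And>d. d \<in> D \<Longrightarrow> 0 \<le> f d"
  shows "0 \<le> f x"
proof (rule ccontr)
  assume "\<not> 0 \<le> f x"
  moreover have "open {x. f x < 0}" using f by (intro open_Collect_less) auto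
  ultimately obtain d where "d \<in> D" "f d < 0" using D[of "{x. f x < 0}"] by (auto simp: not_le)
  with nonneg show False by force
qed

lemma Lp_dissipative_necessary:
  fixes A :: "'n \<Rightarrow> real ^ 'n \<Rightarrow> complex ^ 'm ^ 'm"
  assumes \<Omega>: "open \<Omega>" and p: "2 \<le> p"
    and A: "\<And>h i j. (\<lambda>x. A h x $ i $ j) locally_integrable_on \<Omega>"
    and diss: "Lp_dissipative p \<Omega> A"
  shows "AE x\<in>\<Omega> in lebesgue. \<forall>\<xi> z h.
    0 \<le> Re (herm_inner (A h x *v \<xi>) (powr_scale_deriv (p - 2) z \<xi>))"
proof -
  define q where "q = (\<lambda>h x y. Re (herm_inner (A h x *v snd y) (powr_scale_deriv (p - 2) (fst y) (snd y))))"
  obtain D :: "((complex ^ 'm) \<times> (complex ^ 'm)) set"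
    where D: "countable D" "\<And>U. open U \<Longrightarrow> U \<noteq> {} \<Longrightarrow> \<exists>d\<in>D. d \<in> U"
    using countable_dense_exists by blast
  have "AE x\<in>\<Omega> in lebesgue. 0 \<le> q h x y" for h y
    unfolding q_def
  proof (rule AE_nonneg_if_test_integrals_nonneg[OF \<Omega>])
    show "0 < p" using p by simp
  qed (use locally_integrable_on_herm_inner_matrix[OF A] oscillating_test_functions[OF p A diss] in blast)+
  \<comment> \<open>The exceptional null set depends on \<open>h\<close> and on the pair
    \<open>y\<close>; restricting \<open>y\<close> to the countable set \<open>D\<close> allows one
    common null set, and continuity in \<open>y\<close> recovers all pairs.\<close>
  then have "AE x in lebesgue. \<forall>h\<in>UNIV. \<forall>y\<in>D. x \<in> \<Omega> \<longrightarrow> 0 \<le> q h x y"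
    using D(1) by (intro AE_finite_allI AE_ball_countable') auto
  then show ?thesis
  proof eventually_elim
    case (elim x)
    have "continuous_on UNIV (q h x)" for h
      unfolding q_def using p by (intro continuous_intros) auto
    from nonneg_if_nonneg_on_dense[OF this D(2)] elim
    have "x \<in> \<Omega> \<Longrightarrow> 0 \<le> q h x y" for h y by blast
    then show ?case by (auto simp: q_def)
  qed
qed

section \<open>Duality between conjugate exponents\<close>

definition adjoint_matrix :: "complex ^ 'n ^ 'm \<Rightarrow> complex ^ 'm ^ 'n"
  where "adjoint_matrix M = (\<chi> i j. cnj (M $ j $ i))"

lemma herm_inner_adjoint_matrix:
  "herm_inner (adjoint_matrix M *v u) v = cnj (herm_inner (M *v v) u)"
  unfolding herm_inner_matrix_vector_mult adjoint_matrix_def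
  by (subst sum.swap) (simp add: mult_ac)

text \<open>Taking adjoints conjugates the form and swaps its arguments. As
  \<open>p / (p - 1) \<ge> 2\<close>, the right side falls under the first clause of the definition,
  with the same power \<open>p / (p - 1) - 2\<close> that the second clause uses for
  \<open>p\<close>.\<close>

lemma Lp_dissipative_adjoint:
  fixes A :: "'n \<Rightarrow> real ^ 'n \<Rightarrow> complex ^ 'm ^ 'm"
  assumes p: "1 < p" "p < 2"
  shows "Lp_dissipative p \<Omega> A \<longleftrightarrow> Lp_dissipative (p / (p - 1)) \<Omega> (\<lambda>h x. adjoint_matrix (A h x))"
proof -
  have "sesq_form \<Omega> (\<lambda>h x. adjoint_matrix (A h x)) u v = cnj (sesq_form \<Omega> A v u)" for u v
  proof -
    have "(\<lambda>x. indicator \<Omega> x *\<^sub>R (\<Sum>h\<in>UNIV. herm_inner (adjoint_matrix (A h x) *v partial_deriv h u x) (partial_deriv h v x))) =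
        (\<lambda>x. cnj (indicator \<Omega> x *\<^sub>R (\<Sum>h\<in>UNIV. herm_inner (A h x *v partial_deriv h v x) (partial_deriv h u x))))"
      by (simp add: herm_inner_adjoint_matrix)
    then show ?thesis
      unfolding sesq_form_def set_lebesgue_integral_def by (simp only: Bochner_Integration.integral_cnj)
  qed
  moreover have "2 \<le> p / (p - 1)" using p by (simp add: field_simps)
  ultimately show ?thesis using p by (simp add: Lp_dissipative_def)
qed

text \<open>Passing to the conjugate exponent changes the sign of \<open>1 - 2 / p\<close>. The
  square does not notice, and in the last term the adjoint reverses the sign of the difference, so
  the two changes cancel.\<close>

lemma dissipativity_form_adjoint_matrix:
  assumes "1 < p"
  shows "dissipativity_form (p / (p - 1)) (adjoint_matrix M) l \<omega> = dissipativity_form p M l \<omega>"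
proof -
  have "1 - 2 / (p / (p - 1)) = - (1 - 2 / p)" using assms by (simp add: field_simps)
  then show ?thesis
    unfolding dissipativity_form_def by (simp only: power2_minus) (simp add: herm_inner_adjoint_matrix algebra_simps)
qed

lemma Lp_dissipative_iff:
  fixes A :: "'n \<Rightarrow> real ^ 'n \<Rightarrow> complex ^ 'm ^ 'm"
  assumes \<Omega>: "open \<Omega>" and p: "2 \<le> p"
    and A: "\<And>h i j. (\<lambda>x. A h x $ i $ j) locally_integrable_on \<Omega>"
  shows "Lp_dissipative p \<Omega> A \<longleftrightarrow>
    (AE x\<in>\<Omega> in lebesgue. \<forall>l \<omega>. norm \<omega> = 1 \<longrightarrow> (\<forall>h. 0 \<le> dissipativity_form p (A h x) l \<omega>))"
proof -
  have "(\<forall>l \<omega>. norm \<omega> = 1 \<longrightarrow> (\<forall>h. 0 \<le> dissipativity_form p (A h x) l \<omega>)) \<longleftrightarrow>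
      (\<forall>\<xi> z h. 0 \<le> Re (herm_inner (A h x *v \<xi>) (powr_scale_deriv (p - 2) z \<xi>)))" for x
    using dissipativity_form_nonneg_iff[OF p, of "A _ x"] by blast
  then show ?thesis
    using Lp_dissipative_sufficient[OF p] Lp_dissipative_necessary[OF \<Omega> p A] by auto
qed

theorem theorem6:
  fixes \<Omega> :: "(real ^ 'n) set"
    and A :: "'n \<Rightarrow> real ^ 'n \<Rightarrow> complex ^ 'm ^ 'm"
    and p :: real
  assumes "open \<Omega>" and "connected \<Omega>" and "\<Omega> \<noteq> {}"
    and "1 < p"
    and "\<And>h i j. (\<lambda>x. A h x $ i $ j) locally_integrable_on \<Omega>"
  shows "Lp_dissipative p \<Omega> A \<longleftrightarrow>
    (AE x\<in>\<Omega> in lebesgue. \<forall>l \<omega> :: complex ^ 'm. norm \<omega> = 1 \<longrightarrow> (\<forall>h.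
      Re (herm_inner (A h x *v l) l)
      - (1 - 2 / p)\<^sup>2 * Re (herm_inner (A h x *v \<omega>) \<omega>) * (Re (herm_inner l \<omega>))\<^sup>2
      - (1 - 2 / p) * Re (herm_inner (A h x *v \<omega>) l - herm_inner (A h x *v l) \<omega>)
          * Re (herm_inner l \<omega>) \<ge> 0))"
proof -
  have "Lp_dissipative p \<Omega> A \<longleftrightarrow>
    (AE x\<in>\<Omega> in lebesgue. \<forall>l \<omega>. norm \<omega> = 1 \<longrightarrow> (\<forall>h. 0 \<le> dissipativity_form p (A h x) l \<omega>))"
  proof (cases "2 \<le> p")
    case True
    then show ?thesis by (rule Lp_dissipative_iff[OF assms(1) _ assms(5)])
  next
    case False
    \<comment> \<open>Conjugation preserves local integrability, so the equivalence applies to the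
      adjoint coefficients at the exponent \<open>p / (p - 1)\<close>; the two duality lemmas carry
      both sides back.\<close>
    have "(\<lambda>x. adjoint_matrix (A h x) $ i $ j) locally_integrable_on \<Omega>" for h i j
      using assms(5)[of h j i]
      by (auto simp: locally_integrable_on_def set_integrable_def adjoint_matrix_def
          complex_integrable_cnj simp flip: complex_cnj_scaleR)
    moreover have "2 \<le> p / (p - 1)" using False assms(4) by (simp add: field_simps)
    ultimately show ?thesis
      using Lp_dissipative_adjoint[of p \<Omega> A] Lp_dissipative_iff[OF assms(1), of "p / (p - 1)" "\<lambda>h x. adjoint_matrix (A h x)"]
        False assms(4) by (simp add: dissipativity_form_adjoint_matrix)
  qed
  then show ?thesis unfolding dissipativity_form_def .
qed

end
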